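(* Let $n\geq 1$ and let $X_1,\dots,X_n$ be independent discrete log-concave random variables (with no assumption on their expectations or signs). Let $X=\sum_{i=1}^n X_i$. Then $$\mathbb{P}(X < \mathbb{E}[X] + 1) \geq \frac{1}{e}.$$
   Context: An integer-valued random variable $Y$ with probability mass function $p(k)=\mathbb{P}(Y=k)$, $k\in\mathbb{Z}$, is called (discrete) log-concave if $p(k)^2 \geq p(k-1)\,p(k+1)$ for all $k\in\mathbb{Z}$ and $Y$ has contiguous support, meaning that $\{k\in\mathbb{Z} : p(k)>0\}$ is a set of consecutive integers (finite or infinite in either direction). *)

theory Defs
  imports "HOL-Probability.Probability"
begin

definition contiguous :: "int set \<Rightarrow> bool" where
  "contiguous S \<longleftrightarrow> (\<forall>a\<in>S. \<forall>b\<in>S. {a..b} \<subseteq> S)"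

definition mass :: "'a measure \<Rightarrow> ('a \<Rightarrow> int) \<Rightarrow> int \<Rightarrow> real" where
  "mass M Y k = measure M {\<omega> \<in> space M. Y \<omega> = k}"

definition log_concave_rv :: "'a measure \<Rightarrow> ('a \<Rightarrow> int) \<Rightarrow> bool" where
  "log_concave_rv M Y \<longleftrightarrow>
     Y \<in> measurable M (count_space UNIV) \<and>
     (\<forall>k. (mass M Y k)\<^sup>2 \<ge> mass M Y (k - 1) * mass M Y (k + 1)) \<and>
     contiguous {k. mass M Y k > 0}"

end

theory Submission
  imports Defs
begin

text \<open>
  Let \<open>F\<close> be the distribution function of the sum \<open>S\<close>, \<open>\<mu>\<close> its mean and \<open>m = \<lceil>\<mu>\<rceil>\<close>. As \<open>S\<close> is
  integer-valued, \<open>S < \<mu> + 1\<close> means \<open>S \<le> m\<close>, so the claim is \<open>ln (F m) \<ge> -1\<close>. Two facts give it.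

  First, \<open>F\<close> is log-concave. This is proved directly for the distribution function, by adding one
  summand at a time: the empty sum has the log-concave step function at \<open>0\<close>, and adding an
  independent summand convolves \<open>F\<close> with a log-concave mass function, which preserves
  log-concavity by the Cauchy--Binet formula for two-by-two minors (\<open>pf2_convolution\<close>,
  \<open>pf2_int_cdf_sum\<close>).

  Secondly, the expectation of \<open>ln (F S)\<close> is at least \<open>-1\<close>, the integral of \<open>ln\<close> over the unit
  interval, because the upper Riemann sum of an increasing function is at least its integral
  (\<open>entropy_step\<close>). A supporting line of the concave function \<open>ln F\<close> at \<open>m\<close> has slope
  \<open>s \<ge> 0\<close>, so Jensen's argument yields
  \<open>-1 \<le> ln (F m) + s * (\<mu> - m) \<le> ln (F m)\<close> (\<open>prob_less_expectation_plus_1_ge\<close>).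

  The argument needs \<open>\<mu>\<close> to be a genuine mean; log-concave mass functions have geometric tails,
  hence finite first moments (\<open>integrable_log_concave\<close>).
\<close>

section \<open>Total positivity of order two\<close>

text \<open>
  Log-concavity without internal zeros, written as nonnegativity of all two-by-two minors of the
  Toeplitz matrix of the sequence. Unlike the three-term inequality it can be used without
  case distinctions on zeros, and it is the form in which the Cauchy--Binet formula applies.
\<close>

definition pf2 :: "(int \<Rightarrow> real) \<Rightarrow> bool" where
  "pf2 a \<longleftrightarrow> (\<forall>k. 0 \<le> a k) \<and>
     (\<forall>k d e. 0 \<le> d \<longrightarrow> 0 \<le> e \<longrightarrow> a k * a (k + d + e) \<le> a (k + d) * a (k + e))"

lemma pf2_nonneg: "pf2 a \<Longrightarrow> 0 \<le> a k"
  by (simp add: pf2_def)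

lemma pf2_minor:
  assumes "pf2 a" "k \<le> l" "k \<le> m" "l + m = k + r"
  shows "a k * a r \<le> a l * a m"
proof -
  have "a k * a (k + (l - k) + (m - k)) \<le> a (k + (l - k)) * a (k + (m - k))"
    using assms unfolding pf2_def by (meson diff_ge_0_iff_ge)
  moreover have "k + (l - k) + (m - k) = r" using assms by simp
  ultimately show ?thesis by simp
qed

lemma pf2_reflect:
  assumes "pf2 a"
  shows "pf2 (\<lambda>k. a (- k))"
  unfolding pf2_def
proof (intro conjI allI impI)
  show "0 \<le> a (- k)" for k using assms by (rule pf2_nonneg)
  fix k d e :: int
  assume "0 \<le> d" "0 \<le> e"
  then have "a (- (k + d + e)) * a (- k) \<le> a (- (k + d)) * a (- (k + e))"
    by (intro pf2_minor[OF assms]) auto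
  then show "a (- k) * a (- (k + d + e)) \<le> a (- (k + d)) * a (- (k + e))"
    by (simp add: mult.commute)
qed

text \<open>
  Where the sequence is positive, the three-term inequality says that the ratio of consecutive
  values decreases; multiplying such ratios gives the general minor. Contiguity of the support
  ensures that either an outer value vanishes, and the claim is trivial, or every intermediate
  value is positive and may be cancelled.
\<close>

lemma pf2_if_log_concave:
  fixes p :: "int \<Rightarrow> real"
  assumes nonneg: "\<And>k. 0 \<le> p k"
    and lc: "\<And>k. p (k - 1) * p (k + 1) \<le> (p k)\<^sup>2"
    and cont: "contiguous {k. p k > 0}"
  shows "pf2 p"
proof -
  have pos: "0 < p l" if "0 < p k" "0 < p m" "k \<le> l" "l \<le> m" for k l m
    using cont that unfolding contiguous_def by fastforce
  have step: "p x * p (x + int e + 1) \<le> p (x + 1) * p (x + int e)" for x e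
  proof (induction e)
    case 0
    show ?case by (simp add: mult.commute)
  next
    case (Suc e)
    let ?y = "x + int e"
    show ?case
    proof (cases "0 < p x \<and> 0 < p (?y + 2)")
      case False
      then have "p x * p (?y + 2) = 0"
        using nonneg[of x] nonneg[of "?y + 2"] by (auto simp: not_less order.antisym)
      then show ?thesis
        using mult_nonneg_nonneg[OF nonneg[of "x + 1"] nonneg[of "?y + 1"]]
        by (auto simp: algebra_simps)
    next
      case True
      then have p: "0 < p ?y" "0 < p (?y + 1)"
        by (auto intro: pos[of x "?y + 2"])
      have "(p x * p (?y + 2)) * (p ?y * p (?y + 1)) = (p x * p (?y + 1)) * (p ?y * p (?y + 2))"
        by simp
      also have "\<dots> \<le> (p (x + 1) * p ?y) * (p (?y + 1))\<^sup>2"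
      proof (rule mult_mono)
        show "p x * p (?y + 1) \<le> p (x + 1) * p ?y" by (rule Suc.IH)
        show "p ?y * p (?y + 2) \<le> (p (?y + 1))\<^sup>2" using lc[of "?y + 1"] by (simp add: add.assoc)
      qed (simp_all add: nonneg)
      also have "\<dots> = (p (x + 1) * p (?y + 1)) * (p ?y * p (?y + 1))"
        by (simp add: power2_eq_square)
      finally show ?thesis
        using p by (simp add: algebra_simps)
    qed
  qed
  have gen: "p k * p (k + int d + int e) \<le> p (k + int d) * p (k + int e)" for k d e
  proof (induction d)
    case 0
    show ?case by simp
  next
    case (Suc d)
    let ?u = "k + int d" and ?v = "k + int d + int e"
    show ?case
    proof (cases "0 < p k \<and> 0 < p (?v + 1)")
      case False
      then have "p k * p (?v + 1) = 0"
        using nonneg[of k] nonneg[of "?v + 1"] by (auto simp: not_less order.antisym)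
      then show ?thesis
        using mult_nonneg_nonneg[OF nonneg[of "?u + 1"] nonneg[of "k + int e"]]
        by (auto simp: algebra_simps)
    next
      case True
      then have p: "0 < p ?u" "0 < p ?v"
        by (auto intro: pos[of k "?v + 1"])
      have "(p k * p (?v + 1)) * (p ?u * p ?v) = (p k * p ?v) * (p ?u * p (?v + 1))"
        by simp
      also have "\<dots> \<le> (p ?u * p (k + int e)) * (p (?u + 1) * p ?v)"
        by (rule mult_mono[OF Suc.IH step]) (simp_all add: nonneg)
      also have "\<dots> = (p (?u + 1) * p (k + int e)) * (p ?u * p ?v)"
        by simp
      finally show ?thesis
        using p by (simp add: algebra_simps)
    qed
  qed
  show ?thesis
    unfolding pf2_def
  proof (intro conjI allI impI)
    show "0 \<le> p k" for k by (rule nonneg)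
    fix k d e :: int
    assume "0 \<le> d" "0 \<le> e"
    then show "p k * p (k + d + e) \<le> p (k + d) * p (k + e)"
      using gen[of k "nat d" "nat e"] by simp
  qed
qed

text \<open>
  This is the Cauchy--Binet formula: a minor of the product of the two Toeplitz matrices is a sum
  over \<open>i < j\<close> of products \<open>A i j * B i j\<close> of minors of the factors. Both factors change sign when \<open>i\<close>
  and \<open>j\<close> are exchanged, so the product is nonnegative for all \<open>i\<close> and \<open>j\<close>, and summing over the
  whole plane, one variable after the other, produces twice the minor.
\<close>

lemma pf2_convolution:
  fixes a b c :: "int \<Rightarrow> real"
  assumes a: "pf2 a" and b: "pf2 b"
    and c: "\<And>k. ((\<lambda>i. a (k - i) * b i) has_sum c k) UNIV"
  shows "pf2 c"
proof -
  have c': "((\<lambda>i. a (k + d - i) * b (i - d)) has_sum c k) UNIV" for k d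
  proof -
    have "((\<lambda>i. a (k - (i - d)) * b (i - d)) has_sum c k) UNIV"
      using c[of k] by (subst has_sum_reindex_bij_betw[where g = "\<lambda>i. i - d" and B = UNIV])
        (auto intro!: bij_betwI[where g = "\<lambda>i. i + d"])
    then show ?thesis by (simp add: algebra_simps)
  qed
  have ineq: "c x * c (y + d) \<le> c (x + d) * c y" if "x \<le> y" "0 \<le> d" for x y d
  proof -
    define A where "A i j = a (x + d - i) * a (y + d - j) - a (x + d - j) * a (y + d - i)" for i j
    define B where "B i j = b i * b (j - d) - b (i - d) * b j" for i j
    have A: "0 \<le> A i j" if "i \<le> j" for i j
      using pf2_minor[OF a, of "x + d - j" "x + d - i" "y + d - j" "y + d - i"] that \<open>x \<le> y\<close>
      by (simp add: A_def)
    have B: "0 \<le> B i j" if "i \<le> j" for i j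
      using pf2_minor[OF b, of "i - d" i "j - d" j] that \<open>0 \<le> d\<close> by (simp add: B_def)
    have anti: "A j i = - A i j" "B j i = - B i j" for i j
      by (simp_all add: A_def B_def)
    have AB: "0 \<le> A i j * B i j" for i j
    proof (cases "i \<le> j")
      case True
      then show ?thesis using A B by simp
    next
      case False
      then show ?thesis using A[of j i] B[of j i] anti[of i j] by (simp add: zero_le_mult_iff)
    qed
    define C where "C i = a (x + d - i) * b i * c y + - (a (x + d - i) * b (i - d) * c (y + d))
        + - (a (y + d - i) * b i * c x) + a (y + d - i) * b (i - d) * c (x + d)" for i
    have expand: "A i j * B i j = a (x + d - i) * b i * (a (y + d - j) * b (j - d))
          + - (a (x + d - i) * b (i - d) * (a (y + d - j) * b j))
          + - (a (y + d - i) * b i * (a (x + d - j) * b (j - d)))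
          + a (y + d - i) * b (i - d) * (a (x + d - j) * b j)" for i j
      by (simp add: A_def B_def algebra_simps)
    have "((\<lambda>j. A i j * B i j) has_sum C i) UNIV" for i
      unfolding expand C_def
      by (intro has_sum_add has_sum_uminusI has_sum_cmult_right c c')
    then have C: "0 \<le> C i" for i
      by (rule has_sum_nonneg) (rule AB)
    have "(C has_sum (c (x + d) * c y + - (c x * c (y + d))
        + - (c (y + d) * c x) + c y * c (x + d))) UNIV"
      unfolding C_def by (intro has_sum_add has_sum_uminusI has_sum_cmult_left c c')
    then have "0 \<le> c (x + d) * c y + - (c x * c (y + d)) + - (c (y + d) * c x) + c y * c (x + d)"
      by (rule has_sum_nonneg) (rule C)
    then show ?thesis by (simp add: mult.commute)
  qed
  show ?thesis
    unfolding pf2_def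
  proof (intro conjI allI impI)
    show "0 \<le> c k" for k
      by (rule has_sum_nonneg[OF c]) (simp add: pf2_nonneg a b)
    fix k d e :: int
    assume "0 \<le> d" "0 \<le> e"
    then show "c k * c (k + d + e) \<le> c (k + d) * c (k + e)"
      using ineq[of k "k + e" d] by (simp add: algebra_simps)
  qed
qed

section \<open>Integrability\<close>

text \<open>
  A summable sequence cannot stay above a positive value forever, so some ratio \<open>p (k + 1) / p k\<close> is less than one.
  The later ratios are no larger, and the right tail is dominated by a geometric one.
\<close>

lemma pf2_summable_first_moment:
  assumes p: "pf2 p" and sum: "p summable_on UNIV" and pos: "0 < p k0"
  shows "summable (\<lambda>n. real n * p (int n))"
proof -
  have nonneg: "0 \<le> p k" for k using p by (rule pf2_nonneg)
  have "p summable_on range (\<lambda>n. k0 + int n)"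
    using sum by (rule summable_on_subset_banach) simp
  then have "(\<lambda>n. p (k0 + int n)) summable_on UNIV"
    by (subst (asm) summable_on_reindex) (auto simp: inj_on_def o_def)
  then have "(\<lambda>n. p (k0 + int n)) \<longlonglongrightarrow> 0"
    by (intro summable_LIMSEQ_zero summable_on_imp_summable)
  then obtain n where n: "p (k0 + int n) < p k0"
    using order_tendstoD(2)[OF _ pos] eventually_sequentially by (metis order_refl)
  have "\<exists>k. p (k + 1) < p k \<and> 0 < p k"
  proof (rule ccontr)
    assume no: "\<not> ?thesis"
    have "p k0 \<le> p (k0 + int m)" for m
    proof (induction m)
      case (Suc m)
      then have "\<not> p (k0 + int m + 1) < p (k0 + int m)" using no pos by force
      with Suc show ?case by (simp add: algebra_simps)
    qed simp
    with n show False by (simp add: not_le[symmetric])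
  qed
  then obtain k where k: "p (k + 1) < p k" "0 < p k" by blast
  define r where "r = p (k + 1) / p k"
  have r: "0 \<le> r" "r < 1" using k nonneg by (auto simp: r_def)
  have geom: "p (y + 1) \<le> r * p y" if "k \<le> y" for y
    using pf2_minor[OF p, of k "k + 1" y "y + 1"] that k(2) by (simp add: r_def field_simps)
  show ?thesis
  proof (rule summable_ratio_test)
    show "(1 + r) / 2 < 1" using r by simp
    fix n assume n: "max (nat k) (nat \<lceil>2 / (1 - r)\<rceil>) \<le> n"
    then have "2 / (1 - r) \<le> real n" by linarith
    then have "2 \<le> real n * (1 - r)" using r by (simp add: field_simps)
    \<comment> \<open>For such \<open>n\<close> the weights \<open>n + 1\<close> and \<open>n\<close> raise the ratio \<open>r\<close> to at most \<open>(1 + r) / 2\<close>.\<close>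
    then have growth: "real (Suc n) * r \<le> (1 + r) / 2 * real n"
      using r by (simp add: field_simps)
    have "real (Suc n) * p (int n + 1) \<le> real (Suc n) * (r * p (int n))"
      using n by (intro mult_left_mono geom) auto
    also have "\<dots> \<le> (1 + r) / 2 * real n * p (int n)"
      using mult_right_mono[OF growth nonneg[of "int n"]] by (simp add: mult.assoc)
    finally show "norm (real (Suc n) * p (int (Suc n))) \<le> (1 + r) / 2 * norm (real n * p (int n))"
      by (simp add: nonneg abs_mult add.commute mult.assoc)
  qed
qed

lemma pf2_summable_on_first_moment:
  assumes p: "pf2 p" and sum: "p summable_on UNIV" and pos: "0 < p k0"
  shows "(\<lambda>k. \<bar>real_of_int k\<bar> * p k) summable_on UNIV"
proof -
  have nonneg: "0 \<le> p k" for k using p by (rule pf2_nonneg)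
  have "(\<lambda>k. p (- k)) summable_on UNIV"
    using sum by (subst summable_on_reindex_bij_betw[where B = UNIV]) (auto intro: bij_uminus)
  then have neg: "summable (\<lambda>n. real n * p (- int n))"
    by (rule pf2_summable_first_moment[OF pf2_reflect[OF p], where ?k0.0 = "- k0"]) (simp add: pos)
  have "(\<lambda>k. \<bar>real_of_int k\<bar> * p k) summable_on range int"
    using summable_nonneg_imp_summable_on[OF pf2_summable_first_moment[OF p sum pos]]
    by (subst summable_on_reindex) (auto simp: o_def nonneg)
  moreover have "(\<lambda>k. \<bar>real_of_int k\<bar> * p k) summable_on range (\<lambda>n. - int n)"
    using summable_nonneg_imp_summable_on[OF neg]
    by (subst summable_on_reindex) (auto simp: o_def nonneg inj_on_def)
  ultimately have "(\<lambda>k. \<bar>real_of_int k\<bar> * p k) summable_on (range int \<union> range (\<lambda>n. - int n))"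
    by (rule summable_on_union)
  also have "range int \<union> range (\<lambda>n. - int n) = UNIV"
    by (auto intro: int_cases2)
  finally show ?thesis .
qed

context prob_space
begin

lemma has_sum_prob_fibres:
  fixes Y :: "'a \<Rightarrow> int"
  assumes [measurable]: "Y \<in> measurable M (count_space UNIV)" and A[measurable]: "A \<in> events"
  shows "((\<lambda>j. prob {\<omega>\<in>A. Y \<omega> = j}) has_sum prob A) UNIV"
proof -
  have [measurable]: "{\<omega>\<in>A. Y \<omega> = j} \<in> events" for j
  proof -
    have "{\<omega>\<in>space M. \<omega> \<in> A \<and> Y \<omega> = j} \<in> events" by measurable
    also have "{\<omega>\<in>space M. \<omega> \<in> A \<and> Y \<omega> = j} = {\<omega>\<in>A. Y \<omega> = j}"
      using sets.sets_into_space[OF A] by auto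
    finally show ?thesis .
  qed
  have bij: "bij_betw int_decode UNIV UNIV" by (rule bij_int_decode)
  have "(\<lambda>n. prob {\<omega>\<in>A. Y \<omega> = int_decode n}) sums prob (\<Union>n. {\<omega>\<in>A. Y \<omega> = int_decode n})"
    by (intro finite_measure_UNION) (auto simp: disjoint_family_on_def int_decode_eq)
  also have "(\<Union>n. {\<omega>\<in>A. Y \<omega> = int_decode n}) = A"
    by (auto intro: int_encode_inverse[symmetric])
  finally have "((\<lambda>n. prob {\<omega>\<in>A. Y \<omega> = int_decode n}) has_sum prob A) UNIV"
    by (rule sums_nonneg_imp_has_sum) simp
  then show ?thesis
    by (subst (asm) has_sum_reindex_bij_betw[OF bij])
qed

lemma integrable_if_summable_first_moment:
  fixes Y :: "'a \<Rightarrow> int"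
  assumes [measurable]: "Y \<in> measurable M (count_space UNIV)"
    and sum: "(\<lambda>k. \<bar>real_of_int k\<bar> * mass M Y k) summable_on UNIV"
  shows "integrable M (\<lambda>\<omega>. real_of_int (Y \<omega>))"
proof (rule integrableI_bounded)
  define B where "B n = {\<omega>\<in>space M. Y \<omega> = int_decode n}" for n
  have [measurable]: "B n \<in> events" for n unfolding B_def by measurable
  have "(\<lambda>n. \<bar>real_of_int (int_decode n)\<bar> * mass M Y (int_decode n)) summable_on UNIV"
    using sum by (subst summable_on_reindex_bij_betw[where B = UNIV]) (auto intro: bij_int_decode)
  then have summ: "summable (\<lambda>n. \<bar>real_of_int (int_decode n)\<bar> * mass M Y (int_decode n))"
    by (rule summable_on_imp_summable)
  have "(\<integral>\<^sup>+\<omega>. ennreal (norm (real_of_int (Y \<omega>))) \<partial>M)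
      = (\<integral>\<^sup>+\<omega>. (\<Sum>n. ennreal \<bar>real_of_int (int_decode n)\<bar> * indicator (B n) \<omega>) \<partial>M)"
  proof (rule nn_integral_cong)
    fix \<omega> assume "\<omega> \<in> space M"
    then have "\<omega> \<in> B (int_encode (Y \<omega>))" by (simp add: B_def)
    then have "(\<Sum>n. ennreal \<bar>real_of_int (int_decode n)\<bar> * indicator (B n) \<omega>)
        = ennreal \<bar>real_of_int (int_decode (int_encode (Y \<omega>)))\<bar>"
      by (intro suminf_cmult_indicator) (auto simp: B_def disjoint_family_on_def int_decode_eq)
    then show "ennreal (norm (real_of_int (Y \<omega>)))
        = (\<Sum>n. ennreal \<bar>real_of_int (int_decode n)\<bar> * indicator (B n) \<omega>)" by simp
  qed
  also have "\<dots> = (\<Sum>n. ennreal (\<bar>real_of_int (int_decode n)\<bar> * mass M Y (int_decode n)))"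
    by (subst nn_integral_suminf)
      (auto simp: nn_integral_cmult_indicator emeasure_eq_measure ennreal_mult' mass_def B_def)
  also have "\<dots> = ennreal (\<Sum>n. \<bar>real_of_int (int_decode n)\<bar> * mass M Y (int_decode n))"
    by (rule suminf_ennreal2[OF _ summ]) (simp add: mass_def)
  finally show "(\<integral>\<^sup>+\<omega>. ennreal (norm (real_of_int (Y \<omega>))) \<partial>M) < \<infinity>" by simp
qed measurable

lemma pf2_mass:
  assumes "log_concave_rv M Y"
  shows "pf2 (mass M Y)"
  using assms by (intro pf2_if_log_concave) (auto simp: log_concave_rv_def mass_def)

lemma integrable_log_concave:
  assumes "log_concave_rv M Y"
  shows "integrable M (\<lambda>\<omega>. real_of_int (Y \<omega>))"
proof -
  have Y: "Y \<in> measurable M (count_space UNIV)"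
    using assms by (simp add: log_concave_rv_def)
  have total: "(mass M Y has_sum 1) UNIV"
    using has_sum_prob_fibres[OF Y sets.top] by (simp add: mass_def[abs_def] prob_space)
  have "\<exists>k. 0 < mass M Y k"
  proof (rule ccontr)
    assume "\<not> ?thesis"
    then have "mass M Y k = 0" for k
      using measure_nonneg by (metis mass_def order_le_less)
    then have "(mass M Y has_sum 0) UNIV" by (intro has_sum_0) simp
    then show False using total has_sum_unique by fastforce
  qed
  then obtain k0 where "0 < mass M Y k0" ..
  then show ?thesis
    using total pf2_mass[OF assms] Y
    by (intro integrable_if_summable_first_moment pf2_summable_on_first_moment)
      (auto simp: summable_on_def)
qed

section \<open>The distribution function of a sum\<close>

definition int_cdf :: "('a \<Rightarrow> int) \<Rightarrow> int \<Rightarrow> real" where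
  "int_cdf Y k = prob {\<omega>\<in>space M. Y \<omega> \<le> k}"

lemma measurable_int_sum:
  fixes X :: "'i \<Rightarrow> 'a \<Rightarrow> int"
  assumes "finite I" "\<And>i. i \<in> I \<Longrightarrow> X i \<in> measurable M (count_space UNIV)"
  shows "(\<lambda>\<omega>. \<Sum>i\<in>I. X i \<omega>) \<in> measurable M (count_space UNIV)"
  using assms
proof (induction I rule: finite_induct)
  case (insert i I)
  then have [measurable]: "X i \<in> measurable M (count_space UNIV)"
    "(\<lambda>\<omega>. \<Sum>i\<in>I. X i \<omega>) \<in> measurable M (count_space UNIV)"
    by auto
  have "(\<lambda>\<omega>. X i \<omega> + (\<Sum>i\<in>I. X i \<omega>)) \<in> measurable M (count_space UNIV)"
    by measurable
  with insert.hyps show ?case by simp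
qed simp

text \<open>
  Working with distribution functions lets the induction start from the empty sum, and conditioning
  on the new summand exhibits the next distribution function as a convolution.
\<close>

lemma pf2_int_cdf_sum:
  assumes "finite I" "indep_vars (\<lambda>_. count_space UNIV) X I"
    and "\<And>i. i \<in> I \<Longrightarrow> log_concave_rv M (X i)"
  shows "pf2 (int_cdf (\<lambda>\<omega>. \<Sum>i\<in>I. X i \<omega>))"
  using assms
proof (induction I rule: finite_induct)
  case empty
  have "int_cdf (\<lambda>\<omega>. \<Sum>i\<in>{}. X i \<omega>) = (\<lambda>k. if 0 \<le> k then 1 else 0)"
    by (auto simp: int_cdf_def prob_space)
  then show ?case by (auto simp: pf2_def)
next
  case (insert i I)
  define S where "S \<omega> = (\<Sum>j\<in>I. X j \<omega>)" for \<omega>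
  have meas: "X j \<in> measurable M (count_space UNIV)" if "j \<in> insert i I" for j
    using insert.prems(2)[OF that] by (simp add: log_concave_rv_def)
  have "indep_vars (\<lambda>_. borel) (\<lambda>j \<omega>. real_of_int (X j \<omega>)) (insert i I)"
    by (rule indep_vars_compose2[OF insert.prems(1)]) simp
  from indep_vars_sum[OF insert.hyps this]
  have indep: "indep_var borel (\<lambda>\<omega>. real_of_int (X i \<omega>)) borel (\<lambda>\<omega>. real_of_int (S \<omega>))"
    by (simp add: S_def)
  have split: "prob {\<omega>\<in>{\<omega>\<in>space M. X i \<omega> + S \<omega> \<le> k}. X i \<omega> = j}
      = int_cdf S (k - j) * mass M (X i) j" for k j
  proof -
    have "prob {\<omega>\<in>{\<omega>\<in>space M. X i \<omega> + S \<omega> \<le> k}. X i \<omega> = j}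
        = prob ((\<lambda>\<omega>. (real_of_int (X i \<omega>), real_of_int (S \<omega>))) -`
            ({real_of_int j} \<times> {..real_of_int (k - j)}) \<inter> space M)"
      by (intro arg_cong[where f = prob]) auto
    also have "\<dots> = prob ((\<lambda>\<omega>. real_of_int (X i \<omega>)) -` {real_of_int j} \<inter> space M)
        * prob ((\<lambda>\<omega>. real_of_int (S \<omega>)) -` {..real_of_int (k - j)} \<inter> space M)"
      by (rule indep_varD[OF indep]) auto
    also have "(\<lambda>\<omega>. real_of_int (X i \<omega>)) -` {real_of_int j} \<inter> space M
        = {\<omega>\<in>space M. X i \<omega> = j}" by auto
    also have "(\<lambda>\<omega>. real_of_int (S \<omega>)) -` {..real_of_int (k - j)} \<inter> space M
        = {\<omega>\<in>space M. S \<omega> \<le> k - j}" by auto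
    finally show ?thesis by (simp add: int_cdf_def mass_def)
  qed
  have conv: "((\<lambda>j. int_cdf S (k - j) * mass M (X i) j)
      has_sum int_cdf (\<lambda>\<omega>. X i \<omega> + S \<omega>) k) UNIV" for k
  proof -
    have "(\<lambda>\<omega>. \<Sum>j\<in>insert i I. X j \<omega>) \<in> measurable M (count_space UNIV)"
      by (rule measurable_int_sum[OF _ meas]) (simp_all add: insert.hyps(1))
    then have "(\<lambda>\<omega>. X i \<omega> + S \<omega>) \<in> measurable M (count_space UNIV)"
      by (simp only: S_def sum.insert[OF insert.hyps])
    then have "{\<omega>\<in>space M. X i \<omega> + S \<omega> \<le> k} \<in> events"
      by (rule measurable_sets_Collect[where P = "\<lambda>z. z \<le> k"]) simp
    then have "((\<lambda>j. prob {\<omega>\<in>{\<omega>\<in>space M. X i \<omega> + S \<omega> \<le> k}. X i \<omega> = j})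
        has_sum prob {\<omega>\<in>space M. X i \<omega> + S \<omega> \<le> k}) UNIV"
      by (intro has_sum_prob_fibres meas insertI1)
    then show ?thesis
      unfolding split by (simp only: int_cdf_def)
  qed
  have "indep_vars (\<lambda>_. count_space UNIV) X I"
    by (rule indep_vars_subset[OF insert.prems(1)]) blast
  then have "pf2 (int_cdf S)"
    unfolding S_def by (rule insert.IH) (rule insert.prems(2), rule insertI2)
  moreover have "pf2 (mass M (X i))"
    by (rule pf2_mass[OF insert.prems(2)]) simp
  ultimately have "pf2 (int_cdf (\<lambda>\<omega>. X i \<omega> + S \<omega>))"
    using conv by (rule pf2_convolution)
  then show ?case
    by (simp only: S_def sum.insert[OF insert.hyps])
qed

section \<open>One variable with a log-concave distribution function\<close>

text \<open>
  The left-hand side is the integral of \<open>ln\<close> from \<open>a\<close> to \<open>b\<close>, and \<open>ln\<close> is at most \<open>ln b\<close> there. The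
  value \<open>ln 0 = 0\<close> makes the antiderivative vanish at \<open>0\<close>, in agreement with its limit.
\<close>

lemma entropy_step:
  fixes a b :: real
  assumes "0 \<le> a" "a \<le> b" "0 < b"
  shows "(b * ln b - b) - (a * ln a - a) \<le> (b - a) * ln b"
proof (cases "a = 0")
  case False
  then have "a * ln (b / a) \<le> a * (b / a - 1)"
    using assms by (intro mult_left_mono ln_le_minus_one) auto
  also have "\<dots> = b - a" using False by (simp add: field_simps)
  finally show ?thesis using assms False by (simp add: ln_div algebra_simps)
qed (use assms in simp)

text \<open>
  The bounds on \<open>ln F\<close> are used under the sum over a window around the origin, where they telescope;
  each window sum is at least \<open>-1\<close>, and only the affine majorant \<open>h\<close> has to be passed to the limit.
  This avoids the integrability of \<open>ln (F Y)\<close>.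
\<close>

lemma prob_less_expectation_plus_1_ge:
  fixes Y :: "'a \<Rightarrow> int"
  assumes Y[measurable]: "Y \<in> measurable M (count_space UNIV)"
    and int: "integrable M (\<lambda>\<omega>. real_of_int (Y \<omega>))"
    and cdf: "pf2 (int_cdf Y)"
  shows "1 / exp 1 \<le> prob {\<omega>\<in>space M. real_of_int (Y \<omega>) < expectation (\<lambda>\<omega>. real_of_int (Y \<omega>)) + 1}"
proof -
  define \<mu> where "\<mu> = expectation (\<lambda>\<omega>. real_of_int (Y \<omega>))"
  define m where "m = \<lceil>\<mu>\<rceil>"
  let ?F = "int_cdf Y"
  have m: "\<mu> \<le> real_of_int m" "real_of_int m < \<mu> + 1"
    unfolding m_def by linarith+
  have event: "prob {\<omega>\<in>space M. real_of_int (Y \<omega>) < \<mu> + 1} = ?F m"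
    unfolding int_cdf_def
  proof (intro arg_cong[where f = prob] Collect_cong conj_cong refl)
    show "real_of_int (Y \<omega>) < \<mu> + 1 \<longleftrightarrow> Y \<omega> \<le> m" for \<omega>
      using m by linarith
  qed
  have F01: "0 \<le> ?F k" "?F k \<le> 1" for k by (simp_all add: int_cdf_def)
  have F_diff: "?F k - ?F (k - 1) = mass M Y k" for k
  proof -
    have "?F k = prob ({\<omega>\<in>space M. Y \<omega> \<le> k - 1} \<union> {\<omega>\<in>space M. Y \<omega> = k})"
      unfolding int_cdf_def by (intro arg_cong[where f = prob]) auto
    also have "\<dots> = ?F (k - 1) + mass M Y k"
      unfolding int_cdf_def mass_def by (intro finite_measure_Union) auto
    finally show ?thesis by simp
  qed
  have F_step: "?F k \<le> ?F (k + 1)" for k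
    using F_diff[of "k + 1"] by (simp add: mass_def) (smt (verit) measure_nonneg)
  \<comment> \<open>Otherwise \<open>Y \<ge> m + 1 > \<mu>\<close> almost surely, so that the mean would exceed itself.\<close>
  have F_pos: "0 < ?F m"
  proof (rule ccontr)
    assume "\<not> 0 < ?F m"
    then have "prob {\<omega>\<in>space M. Y \<omega> \<le> m} = 0"
      using F01(1)[of m] unfolding int_cdf_def by linarith
    then have "AE \<omega> in M. \<not> Y \<omega> \<le> m"
      by (subst (asm) prob_eq_0) auto
    then have "AE \<omega> in M. real_of_int (m + 1) \<le> real_of_int (Y \<omega>)"
      by eventually_elim linarith
    then have "real_of_int (m + 1) \<le> \<mu>"
      unfolding \<mu>_def by (intro integral_ge_const int)
    with m show False by simp
  qed
  \<comment> \<open>The forward difference of \<open>ln F\<close> is finite even where \<open>F (m - 1) = 0\<close>.\<close>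
  define s where "s = ln (?F (m + 1)) - ln (?F m)"
  have s: "0 \<le> s" using F_step[of m] F_pos by (simp add: s_def)
  have exp_s: "exp s = ?F (m + 1) / ?F m"
    using F_pos F_step[of m] by (simp add: s_def exp_diff)
  have up: "?F (m + int j) \<le> ?F m * exp s ^ j" for j
  proof (induction j)
    case (Suc j)
    have "?F m * ?F (m + int j + 1) \<le> ?F (m + 1) * ?F (m + int j)"
      by (rule pf2_minor[OF cdf]) auto
    then have "?F (m + int j + 1) \<le> exp s * ?F (m + int j)"
      using F_pos by (simp add: exp_s field_simps)
    also have "\<dots> \<le> exp s * (?F m * exp s ^ j)" using Suc by simp
    finally show ?case by (simp add: algebra_simps)
  qed simp
  have down: "?F (m - int j) * exp s ^ j \<le> ?F m" for j
  proof (induction j)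
    case (Suc j)
    have "?F (m - int j - 1) * ?F (m + 1) \<le> ?F (m - int j) * ?F m"
      by (rule pf2_minor[OF cdf]) auto
    then have "?F (m - int j - 1) * exp s \<le> ?F (m - int j)"
      using F_pos by (simp add: exp_s field_simps)
    then have "?F (m - int j - 1) * exp s * exp s ^ j \<le> ?F (m - int j) * exp s ^ j"
      by (rule mult_right_mono) simp
    also have "\<dots> \<le> ?F m" by (rule Suc)
    finally show ?case by (simp add: algebra_simps)
  qed simp
  have support: "ln (?F k) \<le> ln (?F m) + s * real_of_int (k - m)" if "0 < ?F k" for k
  proof (cases "m \<le> k")
    case True
    then have "?F k \<le> ?F m * exp s ^ nat (k - m)" using up[of "nat (k - m)"] by simp
    then have "ln (?F k) \<le> ln (?F m * exp s ^ nat (k - m))"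
      using that F_pos by simp
    also have "\<dots> = ln (?F m) + real (nat (k - m)) * s"
      using F_pos by (simp add: ln_mult ln_realpow)
    finally show ?thesis using True by (simp add: mult.commute)
  next
    case False
    then have "?F k * exp s ^ nat (m - k) \<le> ?F m" using down[of "nat (m - k)"] by simp
    then have "ln (?F k * exp s ^ nat (m - k)) \<le> ln (?F m)"
      using that F_pos by simp
    also have "ln (?F k * exp s ^ nat (m - k)) = ln (?F k) + real (nat (m - k)) * s"
      using that by (simp add: ln_mult ln_realpow)
    finally show ?thesis using False by (simp add: algebra_simps)
  qed
  define h where "h k = ln (?F m) + s * real_of_int (k - m)" for k
  define \<phi> where "\<phi> u = u * ln u - u" for u :: real
  have step: "\<phi> (?F k) - \<phi> (?F (k - 1)) \<le> mass M Y k * h k" for k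
  proof (cases "0 < ?F k")
    case True
    have "\<phi> (?F k) - \<phi> (?F (k - 1)) \<le> mass M Y k * ln (?F k)"
      using entropy_step[of "?F (k - 1)" "?F k"] F01(1)[of "k - 1"] F_step[of "k - 1"] True
      by (simp add: F_diff \<phi>_def)
    also have "\<dots> \<le> mass M Y k * h k"
      unfolding h_def by (intro mult_left_mono support True) (simp add: mass_def)
    finally show ?thesis .
  next
    case False
    then have "?F k = 0" "?F (k - 1) = 0"
      using F01(1)[of k] F01(1)[of "k - 1"] F_step[of "k - 1"] by auto
    then show ?thesis using F_diff[of k] by simp
  qed
  \<comment> \<open>The half-open window makes the telescoped sum end at \<open>- int N\<close> and start empty.\<close>
  define T where "T N = (\<lambda>\<omega>. indicator {1 - int N..int N} (Y \<omega>) * h (Y \<omega>))" for N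
  have int_ind: "integrable M (indicat_real {\<omega>\<in>space M. Y \<omega> = k})" for k
    by (intro integrable_real_indicator) (auto simp: emeasure_eq_measure)
  have expT: "expectation (T N) = (\<Sum>k\<in>{1 - int N..int N}. mass M Y k * h k)" for N
  proof -
    have "T N \<omega> = (\<Sum>k\<in>{1 - int N..int N}. h k * indicator {\<omega>\<in>space M. Y \<omega> = k} \<omega>)"
      if "\<omega> \<in> space M" for \<omega>
      using that by (auto simp: T_def indicator_def if_distrib sum.delta cong: if_cong)
    then have "expectation (T N)
        = expectation (\<lambda>\<omega>. \<Sum>k\<in>{1 - int N..int N}. h k * indicator {\<omega>\<in>space M. Y \<omega> = k} \<omega>)"
      by (intro Bochner_Integration.integral_cong) auto
    also have "\<dots> = (\<Sum>k\<in>{1 - int N..int N}. h k * mass M Y k)"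
      using int_ind
      by (subst Bochner_Integration.integral_sum) (auto simp: mass_def)
    finally show ?thesis by (simp add: mult.commute)
  qed
  have T_ge: "-1 \<le> expectation (T N)" for N
  proof -
    have telescope: "\<phi> (?F (int N)) - \<phi> (?F (- int N))
        \<le> (\<Sum>k\<in>{1 - int N..int N}. mass M Y k * h k)"
    proof (induction N)
      case (Suc N)
      have "{1 - int (Suc N)..int (Suc N)} = insert (- int N) (insert (int N + 1) {1 - int N..int N})"
        by auto
      then have "(\<Sum>k\<in>{1 - int (Suc N)..int (Suc N)}. mass M Y k * h k)
          = mass M Y (- int N) * h (- int N) + mass M Y (int N + 1) * h (int N + 1)
            + (\<Sum>k\<in>{1 - int N..int N}. mass M Y k * h k)" by simp
      moreover have "int (Suc N) = int N + 1" "- int (Suc N) = - int N - 1" by simp_all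
      then have "\<phi> (?F (int (Suc N))) = \<phi> (?F (int N + 1))"
        "\<phi> (?F (- int (Suc N))) = \<phi> (?F (- int N - 1))" by (simp_all only:)
      moreover have "\<phi> (?F (int N + 1)) - \<phi> (?F (int N)) \<le> mass M Y (int N + 1) * h (int N + 1)"
        using step[of "int N + 1"] by simp
      ultimately show ?case
        using Suc step[of "- int N"] by linarith
    qed simp
    have "\<phi> (?F (- int N)) \<le> 0"
      using F01[of "- int N"]
      by (cases "?F (- int N) = 0") (auto simp: \<phi>_def mult_le_0_iff intro: order_trans[of _ 0])
    moreover have "-1 \<le> \<phi> (?F (int N))"
      using entropy_step[of "?F (int N)" 1] F01[of "int N"] by (simp add: \<phi>_def)
    ultimately show ?thesis using telescope expT by simp
  qed
  have h_int: "integrable M (\<lambda>\<omega>. h (Y \<omega>))"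
    unfolding h_def using int by auto
  have "(\<lambda>N. expectation (T N)) \<longlonglongrightarrow> expectation (\<lambda>\<omega>. h (Y \<omega>))"
  proof (rule integral_dominated_convergence)
    show "integrable M (\<lambda>\<omega>. \<bar>h (Y \<omega>)\<bar>)" using h_int by simp
    show "AE \<omega> in M. (\<lambda>N. T N \<omega>) \<longlonglongrightarrow> h (Y \<omega>)"
    proof (rule AE_I2)
      fix \<omega>
      have "\<forall>\<^sub>F N in sequentially. T N \<omega> = h (Y \<omega>)"
        using eventually_ge_at_top[of "nat (\<bar>Y \<omega>\<bar> + 1)"]
        by eventually_elim (auto simp: T_def indicator_def)
      then show "(\<lambda>N. T N \<omega>) \<longlonglongrightarrow> h (Y \<omega>)"
        by (rule tendsto_eventually)
    qed
  qed (auto simp: T_def indicator_def)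
  then have "-1 \<le> expectation (\<lambda>\<omega>. h (Y \<omega>))"
    using T_ge by (intro LIMSEQ_le_const) auto
  also have "\<dots> = ln (?F m) + s * (\<mu> - real_of_int m)"
    unfolding h_def \<mu>_def using int by (simp add: prob_space)
  also have "\<dots> \<le> ln (?F m)"
    using s m by (simp add: mult_nonneg_nonpos)
  finally have "exp (-1) \<le> ?F m"
    using F_pos by (simp add: ln_ge_iff)
  then show ?thesis
    using event by (simp add: \<mu>_def exp_minus inverse_eq_divide)
qed

end

theorem mainTheorem2:
  fixes M :: "'a measure" and n :: nat and X :: "nat \<Rightarrow> 'a \<Rightarrow> int"
  assumes "prob_space M"
    and "n \<ge> 1"
    and "prob_space.indep_vars M (\<lambda>_. count_space UNIV) X {1..n}"
    and "\<And>i. i \<in> {1..n} \<Longrightarrow> log_concave_rv M (X i)"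
  shows "measure M {\<omega> \<in> space M.
           real_of_int (\<Sum>i=1..n. X i \<omega>)
             < (\<integral>\<omega>'. real_of_int (\<Sum>i=1..n. X i \<omega>') \<partial>M) + 1} \<ge> 1 / exp 1"
proof -
  interpret prob_space M by (rule assms(1))
  show ?thesis
  proof (rule prob_less_expectation_plus_1_ge)
    show "(\<lambda>\<omega>. \<Sum>i=1..n. X i \<omega>) \<in> measurable M (count_space UNIV)"
      using assms(4) by (intro measurable_int_sum) (auto simp: log_concave_rv_def)
    show "integrable M (\<lambda>\<omega>. real_of_int (\<Sum>i=1..n. X i \<omega>))"
      using assms(4) by (simp only: of_int_sum) (intro Bochner_Integration.integrable_sum integrable_log_concave)
    show "pf2 (int_cdf (\<lambda>\<omega>. \<Sum>i=1..n. X i \<omega>))"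
      using assms(3,4) by (intro pf2_int_cdf_sum) auto
  qed
qed

end
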